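(* Let $n\ge 2$. The term rewriting system $\rightarrowtail_{\mathrm{hnf}}$ on $\nu_n$-terms, given by the rules $(h_0)$ $q(\mathsf e_i,x_1,\dots,x_n)\rightarrowtail x_i$ (for each $1\le i\le n$) and $(h_1)$ $q(q(x,y_1,\dots,y_n),z_1,\dots,z_n)\rightarrowtail q(x,q(y_1,z_1,\dots,z_n),\dots,q(y_n,z_1,\dots,z_n))$, is terminating and confluent.
   Context: $\nu_n$ is the type with one $(n+1)$-ary function symbol $q$ and constants $\mathsf e_1,\dots,\mathsf e_n$; terms are built over a countable set of variables. In the rules, $x,x_i,y_i,z_j$ are variables of the rule schemes, to be instantiated by arbitrary terms, and rules may be applied to any subterm. Terminating means there is no infinite rewrite sequence; confluent means that any two terms reachable by rewriting from a common term can be rewritten to a common term. *)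

theory Defs
  imports "HOL-Library.Countable" "HOL-Library.Confluence"
begin

(* Raw terms: the arity of q and the range of the constant indices are only
   enforced by nu_term below, since n is a parameter. *)
datatype 'v raw_term =
    Var 'v
  | E nat
  | Q "'v raw_term" "'v raw_term list"

inductive nu_term :: "nat \<Rightarrow> 'v raw_term \<Rightarrow> bool" for n where
  Var: "nu_term n (Var v)"
| E: "\<lbrakk>1 \<le> i; i \<le> n\<rbrakk> \<Longrightarrow> nu_term n (E i)"
| Q: "\<lbrakk>nu_term n x; length ys = n; \<forall>y \<in> set ys. nu_term n y\<rbrakk> \<Longrightarrow> nu_term n (Q x ys)"

(* The constants are indexed from 1, list positions from 0. Every rule demands that
   the left-hand side is a nu_n-term, so this is a relation on nu_n-terms only. *)
inductive hnf_step :: "nat \<Rightarrow> 'v raw_term \<Rightarrow> 'v raw_term \<Rightarrow> bool" for n where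
  h0: "\<lbrakk>nu_term n (Q (E i) xs)\<rbrakk> \<Longrightarrow> hnf_step n (Q (E i) xs) (xs ! (i - 1))"
| h1: "\<lbrakk>nu_term n (Q (Q x ys) zs)\<rbrakk>
    \<Longrightarrow> hnf_step n (Q (Q x ys) zs) (Q x (map (\<lambda>y. Q y zs) ys))"
| head: "\<lbrakk>nu_term n (Q x ys); hnf_step n x x'\<rbrakk> \<Longrightarrow> hnf_step n (Q x ys) (Q x' ys)"
| arg: "\<lbrakk>nu_term n (Q x ys); k < n; hnf_step n (ys ! k) y'\<rbrakk>
    \<Longrightarrow> hnf_step n (Q x ys) (Q x (ys[k := y']))"

definition terminating :: "('a \<Rightarrow> 'a \<Rightarrow> bool) \<Rightarrow> bool" where
  "terminating r \<longleftrightarrow> \<not> (\<exists>f :: nat \<Rightarrow> 'a. \<forall>i. r (f i) (f (Suc i)))"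

inductive_cases nu_term_EE: "nu_term n (E i)"
inductive_cases nu_term_QE: "nu_term n (Q x ys)"

lemma hnf_step_nu_term:
  assumes "hnf_step n s t"
  shows "nu_term n s \<and> nu_term n t"
  using assms
proof induction
  case (h0 i xs)
  then show ?case by (auto elim!: nu_term_QE nu_term_EE)
next
  case (h1 x ys zs)
  then show ?case by (auto elim!: nu_term_QE intro!: nu_term.Q)
next
  case (head x ys x')
  then show ?case by (auto elim!: nu_term_QE intro!: nu_term.Q)
next
  case (arg x ys k y')
  then show ?case
    by (auto elim!: nu_term_QE intro!: nu_term.Q dest: set_update_subset_insert[THEN subsetD])
qed

end

theory Submission
  imports Defs
begin

text \<open>
  Termination: interpret the variables and constants by \<open>1\<close> and \<open>q(x, y\<^sub>1, \<dots>, y\<^sub>n)\<close> by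
  \<open>x (1 + y\<^sub>1 + \<dots> + y\<^sub>n)\<close>; every step lowers the value. Confluence: reading a term as a
  decision tree with exits \<open>e\<^sub>1, \<dots>, e\<^sub>n\<close>, one can graft terms onto its exits. Replacing every \<open>q\<close>
  by grafting sends each term to one of its reducts, and this normal form is unchanged by rewriting,
  so no critical pairs have to be examined.
\<close>

fun weight :: "'v raw_term \<Rightarrow> nat" where
  "weight (Var v) = 1"
| "weight (E i) = 1"
| "weight (Q x ys) = weight x * Suc (sum_list (map weight ys))"

lemma weight_pos: "weight t > 0"
  by (induction t) auto

lemma sum_list_update_less:
  fixes f :: "'a \<Rightarrow> nat"
  assumes "k < length ys" "f y < f (ys ! k)"
  shows "sum_list (map f (ys[k := y])) < sum_list (map f ys)"
  using assms by (induction ys arbitrary: k) (auto split: nat.split simp: less_Suc_eq_0_disj)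

lemma hnf_step_weight:
  assumes "n \<ge> 1" "hnf_step n s t"
  shows "weight t < weight s"
  using assms(2)
proof induction
  case (h0 i xs)
  then have "xs ! (i - 1) \<in> set xs"
    by (auto elim!: nu_term_QE nu_term_EE)
  then have "weight (xs ! (i - 1)) \<le> sum_list (map weight xs)"
    by (intro member_le_sum_list) auto
  then show ?case by simp
next
  case (h1 x ys zs)
  define Y Z where "Y = sum_list (map weight ys)" and "Z = sum_list (map weight zs)"
  \<comment> \<open>The two sides weigh \<open>weight x * (1 + Y) * (1 + Z)\<close> and
    \<open>weight x * (1 + Y * (1 + Z))\<close>. The gap \<open>weight x * Z\<close> is positive
    because \<open>zs\<close> is nonempty.\<close>
  from h1 assms(1) obtain z zs' where "zs = z # zs'"
    by (cases zs) (auto elim!: nu_term_QE)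
  then have "Z > 0"
    using weight_pos[of z] by (simp add: Z_def)
  have "weight (Q x (map (\<lambda>y. Q y zs) ys)) = weight x * Suc (Y * Suc Z)"
    by (simp add: Y_def Z_def comp_def sum_list_mult_const[symmetric] del: mult_Suc_right)
  also have "\<dots> < weight x * (Suc Y * Suc Z)"
    using \<open>Z > 0\<close> weight_pos[of x] by (intro mult_strict_left_mono) auto
  finally show ?case
    by (simp add: Y_def Z_def mult.assoc del: mult_Suc_right mult_Suc)
next
  case (head x ys x')
  then show ?case by (simp add: add_less_le_mono)
next
  case (arg x ys k y')
  then have "k < length ys" by (auto elim: nu_term_QE)
  with arg.IH show ?case
    using sum_list_update_less[of k ys weight y'] weight_pos[of x] by simp
qed

lemma terminating_hnf_step:
  assumes "n \<ge> 1"
  shows "terminating (hnf_step n :: 'a raw_term \<Rightarrow> 'a raw_term \<Rightarrow> bool)"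
  unfolding terminating_def
proof
  assume "\<exists>f :: nat \<Rightarrow> 'a raw_term. \<forall>i. hnf_step n (f i) (f (Suc i))"
  then obtain f :: "nat \<Rightarrow> 'a raw_term" where "\<forall>i. (f (Suc i), f i) \<in> measure weight"
    using hnf_step_weight[OF assms] by auto
  then show False
    using wf_measure wf_iff_no_infinite_down_chain by blast
qed

text \<open>Designed to be a reduct of \<open>Q t zs\<close>: \<open>h0\<close> and
  \<open>h1\<close> justify the clauses for \<open>E\<close> and \<open>Q\<close>, while a variable
  head matches neither rule, so its \<open>Q\<close> remains.\<close>

fun graft :: "'v raw_term \<Rightarrow> 'v raw_term list \<Rightarrow> 'v raw_term" where
  "graft (Var v) zs = Q (Var v) zs"
| "graft (E i) zs = zs ! (i - 1)"
| "graft (Q x ys) zs = graft x (map (\<lambda>y. graft y zs) ys)"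

text \<open>The head \<open>x\<close> is not normalised first, since \<open>graft\<close> already
  recurses through it.\<close>

fun hnf :: "'v raw_term \<Rightarrow> 'v raw_term" where
  "hnf (Q x ys) = graft x (map hnf ys)"
| "hnf t = t"

text \<open>For \<open>h1\<close>, both sides unfold to the same nested graft. The result serves
  steps inside a head, which \<open>hnf\<close> hands to \<open>graft\<close> unreduced.\<close>

lemma graft_hnf_step: "hnf_step n s t \<Longrightarrow> graft s zs = graft t zs"
proof (induction arbitrary: zs rule: hnf_step.induct)
  case (h0 i xs)
  then show ?case by (auto elim!: nu_term_QE nu_term_EE)
next
  case (h1 x ys ws)
  then show ?case by (simp add: comp_def)
next
  case (arg x ys k y')
  then show ?case
    \<comment> \<open>Mapping turns the update at \<open>k\<close> into an update by the value
      already there, since \<open>ys ! k\<close> and \<open>y'\<close> have equal grafts.\<close>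
    by (metis graft.simps(3) list_update_id map_update)
qed simp

lemma hnf_hnf_step: "hnf_step n s t \<Longrightarrow> hnf s = hnf t"
proof (induction rule: hnf_step.induct)
  case (h0 i xs)
  then show ?case by (auto elim!: nu_term_QE nu_term_EE)
next
  case (h1 x ys ws)
  then show ?case by (simp add: comp_def)
next
  case (head x ys x')
  then show ?case using graft_hnf_step by simp
next
  case (arg x ys k y')
  then show ?case
    by (metis hnf.simps(1) list_update_id map_update)
qed

lemma hnf_hnf_steps: "(hnf_step n)\<^sup>*\<^sup>* s t \<Longrightarrow> hnf s = hnf t"
  by (induction rule: rtranclp_induct) (auto dest: hnf_hnf_step)

lemma hnf_steps_nu_term: "(hnf_step n)\<^sup>*\<^sup>* s t \<Longrightarrow> nu_term n s \<Longrightarrow> nu_term n t"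
  by (induction rule: rtranclp_induct) (auto dest: hnf_step_nu_term)

lemma hnf_steps_arg:
  assumes "(hnf_step n)\<^sup>*\<^sup>* y y'" "nu_term n (Q x (us @ y # vs))"
  shows "(hnf_step n)\<^sup>*\<^sup>* (Q x (us @ y # vs)) (Q x (us @ y' # vs))"
  using assms(1)
proof (induction rule: rtranclp_induct)
  case (step y' y'')
  have "nu_term n (Q x (us @ y' # vs))"
    using hnf_steps_nu_term[OF step.IH assms(2)] .
  moreover have "length us < n"
    using assms(2) by (auto elim: nu_term_QE)
  ultimately have "hnf_step n (Q x (us @ y' # vs)) (Q x (us @ y'' # vs))"
    using hnf_step.arg[of n x "us @ y' # vs" "length us" y''] step.hyps(2) by simp
  with step.IH show ?case by simp
qed simp

text \<open>Arguments are rewritten from left to right; the prefix \<open>us\<close> collects those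
  already done.\<close>

lemma hnf_steps_args:
  assumes "\<And>y. y \<in> set ys \<Longrightarrow> (hnf_step n)\<^sup>*\<^sup>* (f y) (g y)" "nu_term n (Q x (us @ map f ys))"
  shows "(hnf_step n)\<^sup>*\<^sup>* (Q x (us @ map f ys)) (Q x (us @ map g ys))"
  using assms
proof (induction ys arbitrary: us)
  case (Cons y ys)
  have 1: "(hnf_step n)\<^sup>*\<^sup>* (Q x (us @ f y # map f ys)) (Q x (us @ g y # map f ys))"
    using Cons.prems by (intro hnf_steps_arg) auto
  then have "nu_term n (Q x ((us @ [g y]) @ map f ys))"
    using hnf_steps_nu_term Cons.prems(2) by fastforce
  then have "(hnf_step n)\<^sup>*\<^sup>* (Q x ((us @ [g y]) @ map f ys)) (Q x ((us @ [g y]) @ map g ys))"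
    using Cons.prems(1) by (intro Cons.IH) auto
  with 1 show ?case by simp
qed simp

text \<open>For a head \<open>Q x ys\<close>, \<open>h1\<close> moves \<open>zs\<close> into each
  \<open>y\<close>, those inner terms reduce to grafts, and the hypothesis for \<open>x\<close>
  applies to the new list of grafts; hence \<open>zs\<close> must be arbitrary.\<close>

lemma hnf_steps_graft: "nu_term n (Q t zs) \<Longrightarrow> (hnf_step n)\<^sup>*\<^sup>* (Q t zs) (graft t zs)"
proof (induction t arbitrary: zs)
  case (E i)
  from hnf_step.h0[OF E] show ?case by auto
next
  case (Q x ys)
  let ?s = "Q x (map (\<lambda>y. Q y zs) ys)" and ?t = "Q x (map (\<lambda>y. graft y zs) ys)"
  have step: "hnf_step n (Q (Q x ys) zs) ?s"
    using Q.prems by (rule hnf_step.h1)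
  then have s: "nu_term n ?s"
    using hnf_step_nu_term by blast
  have "(hnf_step n)\<^sup>*\<^sup>* (Q y zs) (graft y zs)" if "y \<in> set ys" for y
    using Q.IH(2)[OF that] s that by (auto elim: nu_term_QE)
  then have st: "(hnf_step n)\<^sup>*\<^sup>* ?s ?t"
    using hnf_steps_args[of ys n "\<lambda>y. Q y zs" "\<lambda>y. graft y zs" x "[]"] s by simp
  have "(hnf_step n)\<^sup>*\<^sup>* ?t (graft (Q x ys) zs)"
    using Q.IH(1) hnf_steps_nu_term[OF st s] by simp
  with step st show ?case
    by (meson converse_rtranclp_into_rtranclp rtranclp_trans)
qed simp

text \<open>Innermost strategy: first the arguments reach their \<open>hnf\<close>, then the root
  \<open>Q\<close> is replaced by grafting.\<close>

lemma hnf_steps_hnf: "nu_term n t \<Longrightarrow> (hnf_step n)\<^sup>*\<^sup>* t (hnf t)"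
proof (induction rule: nu_term.induct)
  case (Q x ys)
  have t: "nu_term n (Q x ys)"
    using Q by (auto intro: nu_term.Q)
  have st: "(hnf_step n)\<^sup>*\<^sup>* (Q x ys) (Q x (map hnf ys))"
    using hnf_steps_args[of ys n "\<lambda>y. y" hnf x "[]"] Q t by simp
  then show ?case
    using hnf_steps_graft[OF hnf_steps_nu_term[OF st t]] by simp
qed simp_all

lemma confluentp_hnf_step: "confluentp (hnf_step n)"
proof (rule confluentpI)
  fix s t u :: "'v raw_term"
  assume st: "(hnf_step n)\<^sup>*\<^sup>* s t" and su: "(hnf_step n)\<^sup>*\<^sup>* s u"
  show "\<exists>v. (hnf_step n)\<^sup>*\<^sup>* t v \<and> (hnf_step n)\<^sup>*\<^sup>* u v"
  proof (cases "nu_term n s")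
    case True
    \<comment> \<open>The common reduct is \<open>hnf t\<close>, which equals \<open>hnf s\<close>
      and \<open>hnf u\<close>.\<close>
    then show ?thesis
      using hnf_steps_hnf hnf_steps_nu_term hnf_hnf_steps st su by metis
  next
    case False
    \<comment> \<open>A raw term outside \<open>nu_term n\<close> admits no step.\<close>
    then have "t = s" "u = s"
      using st su by (auto elim: converse_rtranclpE dest: hnf_step_nu_term)
    then show ?thesis by auto
  qed
qed

theorem theorem7p9:
  fixes n :: nat
  assumes "n \<ge> 2"
  shows "terminating (hnf_step n :: 'v::countable raw_term \<Rightarrow> 'v raw_term \<Rightarrow> bool)
       \<and> confluentp (hnf_step n :: 'v raw_term \<Rightarrow> 'v raw_term \<Rightarrow> bool)"
  using assms by (simp add: terminating_hnf_step confluentp_hnf_step)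

end
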